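(* For every Hausdorff space $X$ we have $|X|\le 2^{2^{\mathrm{pd}(X)}}$.
   Context: For a topological space $X$ with topology $\tau_X$, a neighborhood assignment on $X$ is a map $U:X\to\tau_X$ with $x\in U(x)$ for all $x\in X$. A set $A\subseteq X$ pins down $U$ if $A\cap U(x)\neq\emptyset$ for all $x\in X$. The pinning down number $\mathrm{pd}(X)$ is the smallest cardinal $\kappa$ such that every neighborhood assignment on $X$ can be pinned down by a subset of $X$ of size $\kappa$. *)

theory Defs
  imports "HOL-Analysis.Analysis"
begin

unbundle cardinal_syntax

definition nbhd_assignment :: "'a topology \<Rightarrow> ('a \<Rightarrow> 'a set) \<Rightarrow> bool" where
  "nbhd_assignment X U \<longleftrightarrow> (\<forall>x \<in> topspace X. openin X (U x) \<and> x \<in> U x)"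

definition pins_down :: "'a topology \<Rightarrow> 'a set \<Rightarrow> ('a \<Rightarrow> 'a set) \<Rightarrow> bool" where
  "pins_down X A U \<longleftrightarrow> A \<subseteq> topspace X \<and> (\<forall>x \<in> topspace X. A \<inter> U x \<noteq> {})"

definition pinnable :: "'a topology \<Rightarrow> 'b rel \<Rightarrow> bool" where
  "pinnable X r \<longleftrightarrow>
     (\<forall>U. nbhd_assignment X U \<longrightarrow> (\<exists>A. pins_down X A U \<and> |A| =o r))"

text \<open>As for \<^const>\<open>card_of\<close>, a cardinal is represented by a cardinal order, unique only up
  to order isomorphism, hence the choice operator. Quantifying over cardinal orders on
  the type of the points loses nothing: \<open>pd_least\<close> below gives minimality among
  cardinal orders on all types.\<close>

definition pd :: "'a topology \<Rightarrow> 'a rel" where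
  "pd X = (SOME r. Card_order r \<and> pinnable X r \<and>
     (\<forall>s :: 'a rel. Card_order s \<and> pinnable X s \<longrightarrow> r \<le>o s))"

lemma pinnable_topspace: "pinnable X |topspace X|"
  unfolding pinnable_def pins_down_def nbhd_assignment_def
  by (meson card_of_refl disjoint_iff order_refl)

lemma pd_props:
  fixes X :: "'a topology"
  shows Card_order_pd: "Card_order (pd X)"
    and pinnable_pd: "pinnable X (pd X)"
    and pd_le: "\<And>s :: 'a rel. Card_order s \<Longrightarrow> pinnable X s \<Longrightarrow> pd X \<le>o s"
proof -
  let ?R = "{r :: 'a rel. Card_order r \<and> pinnable X r}"
  have "|topspace X| \<in> ?R"
    using pinnable_topspace card_of_Card_order by blast
  then have "\<exists>r \<in> ?R. \<forall>s \<in> ?R. r \<le>o s"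
    by (intro exists_minim_Card_order) auto
  then have "\<exists>r :: 'a rel. Card_order r \<and> pinnable X r \<and>
     (\<forall>s :: 'a rel. Card_order s \<and> pinnable X s \<longrightarrow> r \<le>o s)"
    by blast
  from someI_ex[OF this, folded pd_def]
  show "Card_order (pd X)" "pinnable X (pd X)"
    "Card_order s \<Longrightarrow> pinnable X s \<Longrightarrow> pd X \<le>o s" for s :: "'a rel"
    by blast+
qed

lemma pd_least:
  fixes X :: "'a topology" and s :: "'b rel"
  assumes "pinnable X s"
  shows "pd X \<le>o s"
proof -
  have "nbhd_assignment X (\<lambda>x. topspace X)"
    by (simp add: nbhd_assignment_def)
  then obtain B :: "'a set" where B: "|B| =o s"
    using assms unfolding pinnable_def by blast
  have "pinnable X |B|"
    using assms B unfolding pinnable_def by (meson ordIso_symmetric ordIso_transitive)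
  then have "pd X \<le>o |B|"
    by (simp add: card_of_Card_order pd_le)
  then show ?thesis
    using B ordLeq_ordIso_trans by blast
qed

end

theory Submission
  imports Defs
begin

text \<open>
  Let \<open>\<kappa> = pd X\<close> be infinite and \<open>\<lambda> = 2 ^ (2 ^ \<kappa>)\<close>, so \<open>\<lambda> ^ \<kappa> = \<lambda>\<close>. A family of at most \<open>\<lambda>\<^sup>+\<close> open sets,
  each of size at least \<open>\<lambda>\<^sup>+\<close>, has an injective choice of points, hence can be read as a neighborhood
  assignment, and so some \<open>A\<close> of size \<open>\<kappa>\<close> meets all its members.

  If \<open>\<lambda>\<^sup>+\<close> points have only neighborhoods of size at least \<open>\<lambda>\<^sup>+\<close>, pick disjoint neighborhoods for each
  pair of \<open>\<lambda>\<^sup>+\<close> of them and let \<open>A\<close> meet the intersections of any two neighborhoods chosen for the same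
  point. Then the traces on \<open>A\<close> of its chosen neighborhoods determine a point, so there are at most
  \<open>\<lambda>\<close> of them. Otherwise, if \<open>|X| > \<lambda>\<close>, then \<open>\<lambda>\<^sup>+\<close> points have a neighborhood of size at most \<open>\<lambda>\<close>, and
  the union of these is an open set \<open>S\<close> of size \<open>\<lambda>\<^sup>+\<close>. It has only \<open>\<lambda>\<^sup>+\<close> subsets \<open>A\<close> of size at most \<open>\<kappa>\<close>, with
  closures of size at most \<open>\<lambda>\<close>, so some \<open>B\<close> of size \<open>\<kappa>\<close> meets every \<open>S - cl A\<close>; take \<open>A = B \<inter> S\<close>.
\<close>

no_notation elt_set_eq (infix "=o" 50) \<comment> \<open>clashes with \<open>ordIso\<close>\<close>

section \<open>Cardinal arithmetic\<close>

lemma card_of_subset_le: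
  assumes "A \<subseteq> B" "|B| \<le>o r"
  shows "|A| \<le>o r"
  using card_of_mono1[OF assms(1)] assms(2) by (rule ordLeq_transitive)

lemma card_of_image_le:
  assumes "|A| \<le>o r"
  shows "|f ` A| \<le>o r"
  using card_of_image assms by (rule ordLeq_transitive)

lemma card_of_Pow_ctwo: "|Pow A| =o ctwo ^c |A|"
  unfolding cexp_def ctwo_def Field_card_of by (rule card_of_Pow_Func)

lemma card_of_Pow_mono:
  assumes "|A| \<le>o |B|"
  shows "|Pow A| \<le>o |Pow B|"
proof -
  obtain f where "inj_on f A" "f ` A \<subseteq> B"
    using assms unfolding card_of_ordLeq[symmetric] by auto
  then have "inj_on (image f) (Pow A)" "image f ` Pow A \<subseteq> Pow B"
    by (auto simp: inj_on_image_Pow)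
  then show ?thesis
    unfolding card_of_ordLeq[symmetric] by blast
qed

lemma Pow_Pow_ctwo:
  assumes "Card_order r"
  shows "|Pow (Pow (Field r))| =o ctwo ^c (ctwo ^c r)"
proof -
  have "|Pow (Field r)| =o ctwo ^c r"
    unfolding cexp_def ctwo_def Field_card_of by (rule card_of_Pow_Func)
  then have "ctwo ^c |Pow (Field r)| =o (ctwo ^c (ctwo ^c r) :: (_ \<Rightarrow> bool) rel)"
    by (intro cexp_cong2) (auto intro: Card_order_ctwo Card_order_cexp card_of_Card_order)
  then show ?thesis
    using card_of_Pow_ctwo ordIso_transitive by blast
qed

lemma card_of_Pow_Pow_le:
  assumes "Card_order r" "|A| \<le>o r"
  shows "|Pow (Pow A)| \<le>o ctwo ^c (ctwo ^c r)"
proof -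
  have "|A| \<le>o |Field r|"
    using assms card_of_Field_ordIso ordIso_symmetric ordLeq_ordIso_trans by blast
  then have "|Pow (Pow A)| \<le>o |Pow (Pow (Field r))|"
    by (intro card_of_Pow_mono)
  then show ?thesis
    using Pow_Pow_ctwo[OF assms(1)] ordLeq_ordIso_trans by blast
qed

lemma ex_subset_card_of:
  assumes "Card_order m" "m \<le>o |A|"
  shows "\<exists>B \<subseteq> A. |B| =o m"
proof -
  have "|Field m| \<le>o |A|"
    using assms card_of_Field_ordIso ordIso_ordLeq_trans by blast
  then obtain f where f: "inj_on f (Field m)" "f ` Field m \<subseteq> A"
    unfolding card_of_ordLeq[symmetric] by auto
  then have "|f ` Field m| =o |Field m|"
    using card_of_ordIsoI[OF inj_on_imp_bij_betw] ordIso_symmetric by blast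
  then show ?thesis
    using f assms card_of_Field_ordIso ordIso_transitive by blast
qed

text \<open>By well-founded recursion along the cardinal order of the index set, whose proper initial
  segments are too small to exhaust any \<open>W i\<close>.\<close>

lemma ex_inj_choice:
  fixes W :: "'i \<Rightarrow> 'a set"
  assumes le: "\<And>i. i \<in> I \<Longrightarrow> |I| \<le>o |W i|"
  shows "\<exists>x. inj_on x I \<and> (\<forall>i \<in> I. x i \<in> W i)"
proof -
  define r where "r = |I|"
  have wo: "wo_rel r"
    by (simp add: r_def wo_rel_def card_of_Well_order)
  have Fr: "Field r = I"
    by (simp add: r_def Field_card_of)
  \<comment> \<open>The chosen value avoids all earlier ones, which gives injectivity. It depends on
    \<open>f\<close> only below \<open>i\<close>, which is the admissibility shown next.\<close>
  define H where "H = (\<lambda>f i. SOME v. v \<in> W i \<and> v \<notin> f ` underS r i)"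
  have "wo_rel.adm_wo r H"
    unfolding wo_rel.adm_wo_def[OF wo] H_def
  proof (intro allI impI)
    fix f g :: "'i \<Rightarrow> 'a" and i assume "\<forall>j \<in> underS r i. f j = g j"
    then have "f ` underS r i = g ` underS r i"
      by (intro image_cong) auto
    then show "(SOME v. v \<in> W i \<and> v \<notin> f ` underS r i) = (SOME v. v \<in> W i \<and> v \<notin> g ` underS r i)"
      by simp
  qed
  then have rec: "wo_rel.worec r H i = H (wo_rel.worec r H) i" for i
    using wo_rel.worec_fixpoint[OF wo] by metis
  define x where "x = wo_rel.worec r H"
  have x: "x i \<in> W i \<and> x i \<notin> x ` underS r i" if "i \<in> I" for i
  proof -
    have "|x ` underS r i| <o |W i|"
      using card_of_image[of x "underS r i"] card_of_underS[of r i] le[OF that] that Fr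
      by (metis card_of_Card_order ordLeq_ordLess_trans ordLess_ordLeq_trans r_def)
    then have "\<not> W i \<subseteq> x ` underS r i"
      using card_of_mono1 not_ordLess_ordLeq by blast
    then have "\<exists>v. v \<in> W i \<and> v \<notin> x ` underS r i"
      by blast
    then show ?thesis
      using someI_ex rec[of i] unfolding x_def H_def by (metis (mono_tags, lifting))
  qed
  have "inj_on x I"
  proof (rule inj_onI, rule ccontr)
    fix i j assume ij: "i \<in> I" "j \<in> I" "x i = x j" "i \<noteq> j"
    then have "i \<in> underS r j \<or> j \<in> underS r i"
      using wo_rel.TOTALS[OF wo] Fr unfolding underS_def by blast
    then show False
      using x ij by (metis imageI)
  qed
  then show ?thesis
    using x by blast
qed

text \<open>Every such set is the image of a function from \<open>Field r\<close> to
  \<open>S\<close>. The empty set is left out because a nonempty domain never has it as an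
  image.\<close>

lemma card_of_small_subsets:
  assumes r: "Card_order r" and S: "|S| \<le>o s"
  shows "|{A. A \<subseteq> S \<and> A \<noteq> {} \<and> |A| \<le>o r}| \<le>o s ^c r" (is "|?P| \<le>o _")
proof -
  have "?P \<subseteq> (\<lambda>g. g ` Field r) ` Func (Field r) S"
  proof
    fix A assume A: "A \<in> ?P"
    then have "|A| \<le>o |Field r|"
      using r card_of_Field_ordIso ordIso_symmetric ordLeq_ordIso_trans by blast
    then obtain g where g: "g ` Field r = A"
      using card_of_ordLeq2[of A "Field r"] A by auto
    let ?g = "\<lambda>i. if i \<in> Field r then g i else undefined"
    have "?g \<in> Func (Field r) S" "A = ?g ` Field r"
      using g A by (auto simp: Func_def)
    then show "A \<in> (\<lambda>g. g ` Field r) ` Func (Field r) S"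
      by blast
  qed
  then have "|?P| \<le>o |Func (Field r) S|"
    by (rule surj_imp_ordLeq)
  also have "|Func (Field r) S| =o |S| ^c r"
    by (simp add: cexp_def Field_card_of card_of_refl)
  also have "|S| ^c r \<le>o s ^c r"
    using S r by (rule cexp_mono1)
  finally show ?thesis .
qed

text \<open>By regularity of the successor cardinal, a small subset of \<open>S\<close> lies in one of the initial
  segments \<open>T i\<close> of an enumeration of \<open>S\<close>.\<close>

lemma card_of_small_subsets_cardSuc:
  assumes r: "Card_order r" and L: "Cinfinite L" and pow: "L ^c r \<le>o L" and rL: "r \<le>o L"
    and S: "|S| =o cardSuc L"
  shows "|{A. A \<subseteq> S \<and> A \<noteq> {} \<and> |A| \<le>o r}| \<le>o cardSuc L"
proof -
  let ?m = "cardSuc L"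
  have m: "Card_order ?m" and Cm: "Cinfinite ?m"
    using Cinfinite_cardSuc[OF L] by simp_all
  have wo: "wo_rel ?m"
    using m by (auto simp: wo_rel_def card_order_on_def)
  have "|Field ?m| =o |S|"
    using S m by (meson card_of_Field_ordIso ordIso_symmetric ordIso_transitive)
  then obtain f where f: "bij_betw f (Field ?m) S"
    using card_of_ordIso by blast
  define T where "T i = f ` under ?m i" for i
  let ?Q = "\<lambda>T. {A. A \<subseteq> T \<and> A \<noteq> {} \<and> |A| \<le>o r}"
  have "relChain ?m T"
    unfolding relChain_def T_def
    using wo_rel.TRANS[OF wo] under_incr by (metis image_mono)
  moreover have ST: "S = (\<Union>i \<in> Field ?m. T i)"
  proof -
    have "i \<in> under ?m i" if "i \<in> Field ?m" for i
      using wo_rel.REFL[OF wo] that Refl_under_in by metis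
    moreover have "under ?m i \<subseteq> Field ?m" for i
      by (rule under_Field)
    ultimately show ?thesis
      using f unfolding bij_betw_def T_def by blast
  qed
  ultimately have "\<exists>i \<in> Field ?m. A \<subseteq> T i" if "A \<in> ?Q S" for A
    using that L cardSuc_UNION[of L T A] ordLeq_transitive[OF _ rL]
    by (auto simp: cinfinite_def)
  then have "?Q S \<subseteq> (\<Union>i \<in> Field ?m. ?Q (T i))"
    by blast
  then have "|?Q S| \<le>o |\<Union>i \<in> Field ?m. ?Q (T i)|"
    by (rule card_of_mono1)
  also have "|\<Union>i \<in> Field ?m. ?Q (T i)| \<le>o ?m"
  proof (rule UNION_Cinfinite_bound[OF _ _ Cm])
    show "|Field ?m| \<le>o ?m"
      using m by (simp add: card_of_Field_ordIso ordIso_imp_ordLeq)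
    show "\<forall>i \<in> Field ?m. |?Q (T i)| \<le>o ?m"
    proof
      fix i assume i: "i \<in> Field ?m"
      \<comment> \<open>Proper initial segments of a successor cardinal have size at most
        \<open>L\<close>. Hence so has \<open>T i\<close>, and \<open>pow\<close> bounds its small
        subsets by \<open>L\<close>.\<close>
      have "|underS ?m i| \<le>o L"
        using card_of_underS[OF m i] L by (simp add: cardSuc_ordLeq_ordLess card_of_Card_order)
      moreover have "|{i}| \<le>o L"
        using L by (auto simp: cinfinite_def intro!: Card_order_singl_ordLeq)
      ultimately have "|underS ?m i \<union> {i}| \<le>o L"
        using L by (intro Un_Cinfinite_bound)
      moreover have "under ?m i \<subseteq> underS ?m i \<union> {i}"
        by (auto simp: under_def underS_def)
      ultimately have "|under ?m i| \<le>o L"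
        by (blast intro: card_of_subset_le)
      then have "|T i| \<le>o L"
        unfolding T_def by (rule card_of_image_le)
      then have "|?Q (T i)| \<le>o L ^c r"
        by (rule card_of_small_subsets[OF r])
      then show "|?Q (T i)| \<le>o ?m"
        using ordLeq_transitive[OF ordLeq_transitive[OF _ pow] cardSuc_ordLeq] L by blast
    qed
  qed
  finally show ?thesis .
qed

section \<open>Traces of neighborhoods\<close>

text \<open>The traces on \<open>A\<close> of the sets in \<open>N y\<close> determine
  \<open>y\<close>: if \<open>V\<close> in \<open>N x\<close> misses \<open>W\<close> in
  \<open>N y\<close> but has the trace of some \<open>V'\<close> in \<open>N y\<close>, then
  \<open>A\<close> misses the intersection of \<open>V'\<close> and \<open>W\<close>.
  \<open>N\<close> is arbitrary so that it can consist of all open neighborhoods or only of selected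
  ones.\<close>

lemma card_of_separated_le:
  assumes sep: "\<And>x y. x \<in> Y \<Longrightarrow> y \<in> Y \<Longrightarrow> x \<noteq> y \<Longrightarrow> \<exists>V \<in> N x. \<exists>W \<in> N y. V \<inter> W = {}"
    and meet: "\<And>y V W. y \<in> Y \<Longrightarrow> V \<in> N y \<Longrightarrow> W \<in> N y \<Longrightarrow> A \<inter> (V \<inter> W) \<noteq> {}"
  shows "|Y| \<le>o |Pow (Pow A)|"
proof -
  define t where "t y = (\<lambda>V. A \<inter> V) ` N y" for y
  have "inj_on t Y"
  proof (rule inj_onI, rule ccontr)
    fix x y assume xy: "x \<in> Y" "y \<in> Y" "t x = t y" "x \<noteq> y"
    then obtain V W where V: "V \<in> N x" and W: "W \<in> N y" "V \<inter> W = {}"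
      using sep by blast
    then obtain V' where "V' \<in> N y" "A \<inter> V = A \<inter> V'"
      using xy(3) unfolding t_def by blast
    then show False
      using meet[OF xy(2), of V' W] W by blast
  qed
  moreover have "t ` Y \<subseteq> Pow (Pow A)"
    unfolding t_def by blast
  ultimately show ?thesis
    unfolding card_of_ordLeq[symmetric] by blast
qed

lemma Hausdorff_separating_functions:
  assumes H: "Hausdorff_space X" and Y: "Y \<subseteq> topspace X"
  obtains V W where "\<And>x y. x \<in> Y \<Longrightarrow> y \<in> Y \<Longrightarrow> x \<noteq> y \<Longrightarrow>
      openin X (V x y) \<and> openin X (W x y) \<and> x \<in> V x y \<and> y \<in> W x y \<and> V x y \<inter> W x y = {}"
proof -
  let ?Q = "\<lambda>x y (V, W). openin X V \<and> openin X W \<and> x \<in> V \<and> y \<in> W \<and> V \<inter> W = {}"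
  define P where "P x y = (SOME p. ?Q x y p)" for x y
  have "?Q x y (P x y)" if "x \<in> Y" "y \<in> Y" "x \<noteq> y" for x y
  proof -
    have "x \<in> topspace X" "y \<in> topspace X"
      using that Y by auto
    then have "\<exists>V W. openin X V \<and> openin X W \<and> x \<in> V \<and> y \<in> W \<and> disjnt V W"
      using H \<open>x \<noteq> y\<close> unfolding Hausdorff_space_def by simp
    then have "\<exists>p. ?Q x y p"
      by (simp add: disjnt_def)
    then show ?thesis
      unfolding P_def by (rule someI_ex)
  qed
  then show ?thesis
    by (intro that[of "\<lambda>x y. fst (P x y)" "\<lambda>x y. snd (P x y)"]) (simp add: case_prod_beta)
qed

text \<open>Two open neighborhoods of a point of the closure intersect in a third one, which meets
  \<open>A\<close>. So traces on \<open>A\<close> separate these points.\<close>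

lemma card_of_closure_le:
  assumes "Hausdorff_space X"
  shows "|X closure_of A| \<le>o |Pow (Pow A)|"
proof (rule card_of_separated_le[where N = "\<lambda>x. {V. openin X V \<and> x \<in> V}"])
  fix x y assume "x \<in> X closure_of A" "y \<in> X closure_of A" "x \<noteq> y"
  then have "\<exists>V W. openin X V \<and> openin X W \<and> x \<in> V \<and> y \<in> W \<and> disjnt V W"
    using assms unfolding Hausdorff_space_def by (simp add: in_closure_of)
  then show "\<exists>V \<in> {V. openin X V \<and> x \<in> V}. \<exists>W \<in> {V. openin X V \<and> y \<in> V}. V \<inter> W = {}"
    by (auto simp: disjnt_def)
next
  fix y V W assume "y \<in> X closure_of A" "V \<in> {V. openin X V \<and> y \<in> V}" "W \<in> {V. openin X V \<and> y \<in> V}"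
  then have "openin X (V \<inter> W)" "y \<in> V \<inter> W" "y \<in> X closure_of A"
    by auto
  then show "A \<inter> (V \<inter> W) \<noteq> {}"
    unfolding in_closure_of by blast
qed

section \<open>Pinning down families of open sets\<close>

text \<open>As the points \<open>x i\<close> are distinct, all the \<open>W i\<close> fit into a
  single neighborhood assignment, with the whole space as value at the other points.\<close>

lemma pinnable_inj_family:
  assumes pin: "pinnable X r" and inj: "inj_on x I"
    and W: "\<And>i. i \<in> I \<Longrightarrow> openin X (W i)" "\<And>i. i \<in> I \<Longrightarrow> x i \<in> W i"
  shows "\<exists>A. |A| =o r \<and> (\<forall>i \<in> I. A \<inter> W i \<noteq> {})"
proof -
  define U where "U p = (if p \<in> x ` I then W (the_inv_into I x p) else topspace X)" for p
  have U: "U (x i) = W i" if "i \<in> I" for i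
    using that inj by (simp add: U_def the_inv_into_f_f)
  have "openin X (U p) \<and> p \<in> U p" if "p \<in> topspace X" for p
  proof (cases "p \<in> x ` I")
    case True
    then show ?thesis
      using U W by force
  next
    case False
    then show ?thesis
      using that by (simp add: U_def)
  qed
  then have "nbhd_assignment X U"
    by (simp add: nbhd_assignment_def)
  then obtain A where A: "pins_down X A U" "|A| =o r"
    using pin unfolding pinnable_def by blast
  have "A \<inter> W i \<noteq> {}" if "i \<in> I" for i
    using A(1) U[OF that] W[OF that] openin_subset that unfolding pins_down_def
    by (metis subsetD)
  then show ?thesis
    using A(2) by blast
qed

lemma pinnable_large_family:
  assumes pin: "pinnable X r" and F: "|\<F>| \<le>o m"
    and W: "\<And>W. W \<in> \<F> \<Longrightarrow> openin X W" "\<And>W. W \<in> \<F> \<Longrightarrow> m \<le>o |W|"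
  shows "\<exists>A. |A| =o r \<and> (\<forall>W \<in> \<F>. A \<inter> W \<noteq> {})"
proof -
  have "\<And>W. W \<in> \<F> \<Longrightarrow> |\<F>| \<le>o |W|"
    using F W(2) ordLeq_transitive by blast
  then obtain x where "inj_on x \<F>" "\<forall>W \<in> \<F>. x W \<in> W"
    using ex_inj_choice[of \<F> "\<lambda>W. W"] by blast
  then show ?thesis
    using pinnable_inj_family[OF pin, of x \<F> "\<lambda>W. W"] W(1) by blast
qed

text \<open>Finitely many points have pairwise disjoint neighborhoods, and a pinning set has a point
  in each. This settles finite \<open>r\<close> and shows that singletons have size at most
  \<open>r\<close>.\<close>

lemma Hausdorff_pinnable_finite:
  assumes H: "Hausdorff_space X" and pin: "pinnable X r"
    and F: "finite F" "F \<subseteq> topspace X"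
  shows "|F| \<le>o r"
proof -
  obtain V W where VW: "\<And>x y. x \<in> F \<Longrightarrow> y \<in> F \<Longrightarrow> x \<noteq> y \<Longrightarrow>
      openin X (V x y) \<and> openin X (W x y) \<and> x \<in> V x y \<and> y \<in> W x y \<and> V x y \<inter> W x y = {}"
    using Hausdorff_separating_functions[OF H F(2)] by blast
  \<comment> \<open>Both \<open>V x y\<close> and \<open>W y x\<close> are used, as the separating
    choice need not be symmetric in \<open>x\<close> and \<open>y\<close>. The factor
    \<open>topspace X\<close> keeps \<open>U x\<close> open when \<open>F\<close> is a
    singleton.\<close>
  define U where "U x = topspace X \<inter> (\<Inter>y \<in> F - {x}. V x y \<inter> W y x)" for x
  have "openin X (U x)" "x \<in> U x" if "x \<in> F" for x
  proof -
    have "openin X ((\<Inter>y \<in> F - {x}. V x y \<inter> W y x) \<inter> topspace X)"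
      using F(1) VW that by (intro openin_INT) auto
    then show "openin X (U x)"
      by (simp add: U_def Int_commute)
    show "x \<in> U x"
      using VW that F(2) unfolding U_def by blast
  qed
  then obtain A where A: "|A| =o r" "\<forall>x \<in> F. A \<inter> U x \<noteq> {}"
    using pinnable_inj_family[OF pin, of "\<lambda>x. x" F U] by auto
  then obtain a where a: "\<And>x. x \<in> F \<Longrightarrow> a x \<in> A \<inter> U x"
    using bchoice[of F "\<lambda>x a. a \<in> A \<inter> U x"] by blast
  have "inj_on a F"
  proof (rule inj_onI, rule ccontr)
    fix x y assume xy: "x \<in> F" "y \<in> F" "a x = a y" "x \<noteq> y"
    then have "a x \<in> V x y" "a x \<in> W x y"
      using a[of x] a[of y] unfolding U_def by auto
    then show False
      using VW xy by blast
  qed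
  moreover have "a ` F \<subseteq> A"
    using a by blast
  ultimately have "|F| \<le>o |A|"
    unfolding card_of_ordLeq[symmetric] by blast
  then show ?thesis
    using A(1) ordLeq_ordIso_trans by blast
qed

lemma Hausdorff_pinnable_finite_card:
  assumes H: "Hausdorff_space X" and pin: "pinnable X r" and r: "Card_order r" "finite (Field r)"
  shows "|topspace X| \<le>o r"
proof -
  have bound: "card F \<le> card (Field r)" if "finite F" "F \<subseteq> topspace X" for F
  proof -
    have "|F| \<le>o |Field r|"
      using Hausdorff_pinnable_finite[OF H pin that] r
      by (meson card_of_Field_ordIso ordIso_symmetric ordLeq_ordIso_trans)
    then show ?thesis
      using r(2) by (metis card_of_ordLeq card_inj_on_le)
  qed
  have "finite (topspace X)"
  proof (rule ccontr)
    assume "infinite (topspace X)"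
    then obtain F where "finite F" "F \<subseteq> topspace X" "card F = Suc (card (Field r))"
      using infinite_arbitrarily_large by blast
    then show False
      using bound[of F] by simp
  qed
  then show ?thesis
    using Hausdorff_pinnable_finite[OF H pin] by blast
qed

section \<open>The cardinality bound\<close>

text \<open>\<open>L\<close> stands for the double exponential of \<open>r\<close>; only the bounds
  listed here enter the argument.\<close>

context
  fixes X :: "'a topology" and r :: "'b rel" and L :: "'c rel"
  assumes H: "Hausdorff_space X" and pin: "pinnable X r"
    and r: "Card_order r" and rL: "r \<le>o L" and L: "Cinfinite L" and pow: "L ^c r \<le>o L"
    and exp2: "\<And>A :: 'a set. |A| \<le>o r \<Longrightarrow> |Pow (Pow A)| \<le>o L"
begin

lemma cardSuc_le_iff: "cardSuc L \<le>o |A| \<longleftrightarrow> \<not> |A| \<le>o L"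
  using L by (metis cardSuc_ordLess_ordLeq card_of_Card_order card_of_Well_order
      card_order_on_well_order_on not_ordLeq_iff_ordLess)

lemma Cinfinite_cardSuc_L: "Cinfinite (cardSuc L)" "Card_order (cardSuc L)"
  using Cinfinite_cardSuc[OF L] by auto

lemma not_all_neighborhoods_large:
  assumes Z: "Z \<subseteq> topspace X" "cardSuc L \<le>o |Z|"
  shows "\<exists>x \<in> Z. \<exists>U. openin X U \<and> x \<in> U \<and> |U| \<le>o L"
proof (rule ccontr)
  assume "\<not> ?thesis"
  then have large: "cardSuc L \<le>o |U|" if "openin X U" "x \<in> U" "x \<in> Z" for x U
    using that cardSuc_le_iff by blast
  obtain Y where Y: "Y \<subseteq> Z" "|Y| =o cardSuc L"
    using ex_subset_card_of[OF Cinfinite_cardSuc_L(2) Z(2)] by blast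
  obtain V W where VW: "\<And>x y. x \<in> Y \<Longrightarrow> y \<in> Y \<Longrightarrow> x \<noteq> y \<Longrightarrow>
      openin X (V x y) \<and> openin X (W x y) \<and> x \<in> V x y \<and> y \<in> W x y \<and> V x y \<inter> W x y = {}"
    using Hausdorff_separating_functions[OF H, of Y] Y(1) Z(1) by blast
  define N where "N x = (V x ` (Y - {x})) \<union> ((\<lambda>y. W y x) ` (Y - {x}))" for x
  have N: "openin X G \<and> x \<in> G" if "x \<in> Y" "G \<in> N x" for x G
    using that VW unfolding N_def by auto
  \<comment> \<open>These intersections are again open neighborhoods of points of \<open>Y\<close>,
    hence large, and they are what \<open>A\<close> has to meet for its traces to separate
    \<open>Y\<close>.\<close>
  define \<F> where "\<F> = (\<Union>x \<in> Y. (\<lambda>(G, G'). G \<inter> G') ` (N x \<times> N x))"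
  have YL: "|Y| \<le>o cardSuc L"
    using Y(2) ordIso_imp_ordLeq by blast
  have "|N x| \<le>o cardSuc L" for x
  proof -
    have "|Y - {x}| \<le>o cardSuc L"
      by (rule card_of_subset_le[OF _ YL]) blast
    then show ?thesis
      unfolding N_def using Cinfinite_cardSuc_L by (intro Un_Cinfinite_bound card_of_image_le)
  qed
  then have "|N x \<times> N x| \<le>o cardSuc L" for x
    using Cinfinite_cardSuc_L card_of_Times_ordLeq_infinite_Field cinfinite_def by blast
  then have "|\<F>| \<le>o cardSuc L"
    unfolding \<F>_def using Cinfinite_cardSuc_L YL by (intro UNION_Cinfinite_bound ballI card_of_image_le)
  moreover have "openin X G \<and> cardSuc L \<le>o |G|" if G: "G \<in> \<F>" for G
  proof -
    obtain x where x: "x \<in> Y" "openin X G" "x \<in> G"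
      using G N unfolding \<F>_def by fastforce
    then show ?thesis
      using large Y(1) by blast
  qed
  ultimately obtain A where A: "|A| =o r" "\<forall>G \<in> \<F>. A \<inter> G \<noteq> {}"
    using pinnable_large_family[OF pin, of \<F> "cardSuc L"] by auto
  have "|Y| \<le>o |Pow (Pow A)|"
  proof (rule card_of_separated_le[where N = N])
    fix x y assume xy: "x \<in> Y" "y \<in> Y" "x \<noteq> y"
    then have "V x y \<in> N x" "W x y \<in> N y"
      unfolding N_def by auto
    then show "\<exists>V \<in> N x. \<exists>W \<in> N y. V \<inter> W = {}"
      using VW[OF xy] by blast
  next
    fix y G G' assume "y \<in> Y" "G \<in> N y" "G' \<in> N y"
    then have "G \<inter> G' \<in> \<F>"
      unfolding \<F>_def by force
    then show "A \<inter> (G \<inter> G') \<noteq> {}"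
      using A(2) by blast
  qed
  then have "|Y| \<le>o L"
    using exp2[OF ordIso_imp_ordLeq[OF A(1)]] ordLeq_transitive by blast
  then show False
    using Y(2) cardSuc_le_iff ordIso_imp_ordLeq ordIso_symmetric by blast
qed

lemma not_openin_card_cardSuc:
  assumes S: "openin X S"
  shows "\<not> |S| =o cardSuc L"
proof
  assume Sm: "|S| =o cardSuc L"
  define \<A> where "\<A> = {A. A \<subseteq> S \<and> A \<noteq> {} \<and> |A| \<le>o r}"
  have clA: "|X closure_of A| \<le>o L" if "|A| \<le>o r" for A
    using card_of_closure_le[OF H] exp2[OF that] ordLeq_transitive by blast
  define \<F> where "\<F> = (\<lambda>A. S - X closure_of A) ` \<A>"
  have "|\<A>| \<le>o cardSuc L"
    unfolding \<A>_def using card_of_small_subsets_cardSuc[OF r L pow rL Sm] .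
  then have "|\<F>| \<le>o cardSuc L"
    unfolding \<F>_def by (rule card_of_image_le)
  moreover have "openin X (S - X closure_of A) \<and> cardSuc L \<le>o |S - X closure_of A|"
    if "A \<in> \<A>" for A
  proof
    show "openin X (S - X closure_of A)"
      using S by (simp add: openin_diff)
    have "\<not> |S - X closure_of A| \<le>o L"
    proof
      assume "|S - X closure_of A| \<le>o L"
      then have "|(S - X closure_of A) \<union> X closure_of A| \<le>o L"
        using clA that L unfolding \<A>_def by (intro Un_Cinfinite_bound) auto
      then have "|S| \<le>o L"
        by (rule card_of_subset_le[rotated]) blast
      then show False
        using Sm cardSuc_le_iff ordIso_imp_ordLeq ordIso_symmetric by blast
    qed
    then show "cardSuc L \<le>o |S - X closure_of A|"
      using cardSuc_le_iff by blast
  qed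
  ultimately obtain B where B: "|B| =o r" "\<forall>G \<in> \<F>. B \<inter> G \<noteq> {}"
    using pinnable_large_family[OF pin, of \<F> "cardSuc L"] unfolding \<F>_def by blast
  \<comment> \<open>\<open>B \<inter> S\<close> is now used as one of the small sets in
    \<open>\<A>\<close>: \<open>B\<close> would have to meet \<open>S\<close> outside the closure of
    \<open>B \<inter> S\<close>, which is absurd.\<close>
  have BS: "|B \<inter> S| \<le>o r"
    using B(1) card_of_mono1[of "B \<inter> S" B] ordLeq_ordIso_trans by blast
  show False
  proof (cases "B \<inter> S = {}")
    case False
    then have "S - X closure_of (B \<inter> S) \<in> \<F>"
      using BS unfolding \<F>_def \<A>_def by blast
    then obtain b where b: "b \<in> B \<inter> S" "b \<notin> X closure_of (B \<inter> S)"
      using B(2) by blast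
    moreover have "B \<inter> S \<subseteq> X closure_of (B \<inter> S)"
      using S openin_subset by (intro closure_of_subset) blast
    ultimately show False
      by blast
  next
    \<comment> \<open>The empty set is not in \<open>\<A>\<close>, so this case is separate:
      \<open>B\<close> misses \<open>S\<close>, which forces \<open>\<A>\<close> to be empty, yet it
      contains the singletons of \<open>S\<close>.\<close>
    case True
    have "\<A> = {}"
    proof (rule equals0I)
      fix A assume "A \<in> \<A>"
      then have "B \<inter> (S - X closure_of A) \<noteq> {}"
        using B(2) by (simp add: \<F>_def)
      then show False
        using True by blast
    qed
    moreover have "S \<noteq> {}"
    proof
      assume "S = {}"
      then have "|S| \<le>o L"
        using L by (simp add: Card_order_empty)
      moreover have "cardSuc L \<le>o |S|"
        using Sm by (simp add: ordIso_iff_ordLeq)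
      ultimately show False
        using cardSuc_le_iff[of S] by simp
    qed
    then obtain s where "s \<in> S"
      by blast
    moreover from this have "|{s}| \<le>o r"
      using openin_subset[OF S] by (intro Hausdorff_pinnable_finite[OF H pin]) auto
    ultimately have "{s} \<in> \<A>"
      by (simp add: \<A>_def)
    then show False
      using \<open>\<A> = {}\<close> by simp
  qed
qed

lemma card_of_topspace_le: "|topspace X| \<le>o L"
proof (rule ccontr)
  assume nle: "\<not> ?thesis"
  define G where "G = {x \<in> topspace X. \<exists>U. openin X U \<and> x \<in> U \<and> |U| \<le>o L}"
  have "|topspace X - G| \<le>o L"
    using not_all_neighborhoods_large[of "topspace X - G"] cardSuc_le_iff
    unfolding G_def by blast
  moreover have "|G| \<le>o L"
  proof (rule ccontr)
    assume "\<not> |G| \<le>o L"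
    then obtain Y where Y: "Y \<subseteq> G" "|Y| =o cardSuc L"
      using ex_subset_card_of[OF Cinfinite_cardSuc_L(2)] cardSuc_le_iff by blast
    have "\<exists>U. openin X U \<and> y \<in> U \<and> |U| \<le>o L" if "y \<in> Y" for y
      using that Y(1) unfolding G_def by blast
    then obtain U where U: "\<And>y. y \<in> Y \<Longrightarrow> openin X (U y) \<and> y \<in> U y \<and> |U y| \<le>o L"
      by metis
    \<comment> \<open>A union of \<open>cardSuc L\<close> small open sets, each containing its own
      index, is open and has size exactly \<open>cardSuc L\<close>.\<close>
    let ?S = "\<Union>y \<in> Y. U y"
    have "|?S| \<le>o cardSuc L"
    proof (rule UNION_Cinfinite_bound[OF _ _ Cinfinite_cardSuc_L(1)])
      show "|Y| \<le>o cardSuc L"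
        using Y(2) by (rule ordIso_imp_ordLeq)
      have "L \<le>o cardSuc L"
        using L by (simp add: cardSuc_ordLeq)
      then show "\<forall>y \<in> Y. |U y| \<le>o cardSuc L"
        using U by (auto intro: ordLeq_transitive)
    qed
    moreover have "|Y| \<le>o |?S|"
      using U by (intro card_of_mono1) blast
    then have "cardSuc L \<le>o |?S|"
      using Y(2) ordIso_symmetric ordIso_ordLeq_trans by blast
    ultimately have "|?S| =o cardSuc L"
      by (simp add: ordIso_iff_ordLeq)
    moreover have "openin X ?S"
      using U by blast
    ultimately show False
      using not_openin_card_cardSuc by blast
  qed
  ultimately have "|(topspace X - G) \<union> G| \<le>o L"
    using L by (intro Un_Cinfinite_bound)
  then show False
    using nle card_of_subset_le[of "topspace X" "(topspace X - G) \<union> G"] by blast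
qed

end

theorem theorem4p1:
  fixes X :: "'a topology"
  assumes "Hausdorff_space X"
  shows "|topspace X| \<le>o ctwo ^c (ctwo ^c pd X)"
proof -
  let ?r = "pd X" and ?L = "ctwo ^c (ctwo ^c pd X)"
  have r: "Card_order ?r" and pin: "pinnable X ?r"
    by (fact Card_order_pd pinnable_pd)+
  have less: "?r <o ctwo ^c ?r"
    using r by (rule ordLess_ctwo_cexp)
  also have "ctwo ^c ?r <o ?L"
    by (rule ordLess_ctwo_cexp[OF Card_order_cexp])
  finally have rL: "?r \<le>o ?L"
    by (rule ordLess_imp_ordLeq)
  show ?thesis
  \<comment> \<open>For finite \<open>?r\<close> the cardinal \<open>?L\<close> is finite too and
    has no use as the infinite \<open>L\<close> above; there the space has at most \<open>?r\<close>
    points.\<close>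
  proof (cases "finite (Field ?r)")
    case True
    then show ?thesis
      using Hausdorff_pinnable_finite_card[OF assms pin r] rL ordLeq_transitive by blast
  next
    case False
    then have Cr: "Cinfinite ?r"
      using r by (simp add: cinfinite_def)
    then have C2: "Cinfinite (ctwo ^c ?r)"
      by (rule Cinfinite_cexp[OF ordLeq_refl[OF Card_order_ctwo]])
    then have L: "Cinfinite ?L"
      by (rule Cinfinite_cexp[OF ordLeq_refl[OF Card_order_ctwo]])
    \<comment> \<open>The exponents multiply, and the product of \<open>ctwo ^c ?r\<close> with the
      smaller \<open>?r\<close> is absorbed by the infinite factor
      \<open>ctwo ^c ?r\<close>.\<close>
    have "?L ^c ?r \<le>o ?L"
      using cexp_cprod_ordLeq[OF Card_order_ctwo C2 Cinfinite_Cnotzero[OF Cr]] less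
        ordLess_imp_ordLeq ordIso_imp_ordLeq by blast
    then show ?thesis
      using card_of_topspace_le[OF assms pin r rL L] card_of_Pow_Pow_le[OF r] by blast
  qed
qed

end
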